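(* Let $a,b,n$ be positive integers. For any function $f:\mathbb N\to\mathbb Z$ with $f(k)\binom{2k-1}k\in\mathbb Z$ for all $k\in\mathbb N$, $$\sum_{k=0}^{n-1}\big(f(k+1)-(-1)^{a+b}f(k)\big)\binom{n-1}k^a\binom{-n-1}k^b\in\mathbb Z.$$
   Context: For an integer $x$ and $k\in\mathbb N$, $\binom xk=x(x-1)\cdots(x-k+1)/k!$; in particular $\binom{-1}0=1$. *)

theory Defs
  imports Complex_Main
begin

end

(* Let A_k = binom(n - 1, k), B_k = binom(- n - 1, k).  Summation by parts reduces the claim
   to the divisibility of A_(k-1)^a B_(k-1)^b - (- A_k)^a (- B_k)^b by binom(2 k - 1, k).
   Up to sign this is a difference u^a v^b - u'^a v'^b in which both u (v - v') and
   (u - u') v' are multiples of binom(2 k - 1, k), by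
     binom(n - 1, k - 1) binom(n + k - 1, k) = binom(n + k - 1, 2 k - 1) binom(2 k - 1, k),
     binom(n, k) binom(n + k, k) = 2 binom(n + k, 2 k) binom(2 k - 1, k). *)

theory Submission
  imports Defs
begin

text \<open>Telescope through the mixed term \<open>u ^ a * v' ^ b\<close>. As \<open>x - y\<close>
  divides \<open>x ^ n - y ^ n\<close> and both exponents are positive, each of the two pieces
  retains one factor from the hypotheses.\<close>

lemma dvd_diff_mult_powers:
  fixes d u v u' v' :: "'a::comm_ring_1"
  assumes "d dvd u * (v - v')" and "d dvd (u - u') * v'" and "a > 0" and "b > 0"
  shows "d dvd u ^ a * v ^ b - u' ^ a * v' ^ b"
proof -
  have pow: "x - y dvd x ^ n - y ^ n" for x y :: 'a and n
    by (simp add: power_diff_sumr2)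
  have "u * (v - v') dvd u ^ a * (v ^ b - v' ^ b)"
    using assms(3) by (intro mult_dvd_mono pow dvd_power) auto
  moreover have "(u - u') * v' dvd (u ^ a - u' ^ a) * v' ^ b"
    using assms(4) by (intro mult_dvd_mono pow dvd_power) auto
  ultimately have "d dvd u ^ a * (v ^ b - v' ^ b) + (u ^ a - u' ^ a) * v' ^ b"
    using assms(1,2) by (meson dvd_add dvd_trans)
  then show ?thesis
    by (simp add: algebra_simps)
qed

text \<open>Trinomial revision, choosing a subset inside a subset, gives the cofactor
  \<open>m + Suc k choose (2 * k + 1)\<close>; for k > m the right side is 0.\<close>

lemma central_binomial_dvd_binomial_mult1:
  "(2 * k + 1 choose Suc k) dvd (m choose k) * (m + Suc k choose Suc k)"
proof (cases "k \<le> m")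
  case True
  then have "(m + Suc k choose (2 * k + 1)) * (2 * k + 1 choose Suc k)
      = (m + Suc k choose Suc k) * (m choose k)"
    using choose_mult[of "Suc k" "2 * k + 1" "m + Suc k"] by simp
  then show ?thesis
    by (metis dvd_triv_right mult.commute)
qed (simp add: binomial_eq_0)

text \<open>The same revision yields the central binomial coefficient of \<open>2 * Suc k\<close>,
  which by symmetry and Pascal's rule is twice the divisor.\<close>

lemma central_binomial_dvd_binomial_mult2:
  "(2 * k + 1 choose Suc k) dvd (n choose Suc k) * (n + Suc k choose Suc k)"
proof (cases "Suc k \<le> n")
  case True
  then have "(n + Suc k choose (2 * Suc k)) * (2 * Suc k choose Suc k)
      = (n + Suc k choose Suc k) * (n choose Suc k)"
    using choose_mult[of "Suc k" "2 * Suc k" "n + Suc k"] by simp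
  moreover have "(2 * Suc k choose Suc k) = 2 * (2 * k + 1 choose Suc k)"
    using binomial_symmetric[of k "2 * k + 1"] by simp
  ultimately show ?thesis
    by (metis dvd_triv_right dvd_mult mult.commute)
qed (simp add: binomial_eq_0)

lemma sum_by_parts_twisted:
  fixes f c :: "nat \<Rightarrow> 'a::comm_ring_1"
  shows "(\<Sum>k<n. (f (k + 1) - s * f k) * c k)
    = (\<Sum>k<n. f (k + 1) * (c k - s * c (k + 1))) + s * f n * c n - s * f 0 * c 0"
  by (induction n) (simp_all add: algebra_simps)

text \<open>Upper negation; it moves the second binomial of the theorem into the integers, where
  divisibility is meaningful.\<close>

lemma gbinomial_minus_of_nat:
  "((- of_nat n - 1 :: 'a::field_char_0) gchoose k) = (- 1) ^ k * of_nat (n + k choose k)"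
  by (subst gbinomial_negated_upper) (simp add: binomial_gbinomial add.commute)

lemma central_binomial_dvd_diff:
  fixes m j a b :: nat
  defines "A \<equiv> \<lambda>k. int (m choose k)" and "B \<equiv> \<lambda>k. (- 1) ^ k * int (Suc m + k choose k)"
  assumes "a > 0" and "b > 0"
  shows "int (2 * j + 1 choose Suc j)
    dvd A j ^ a * B j ^ b - (- 1) ^ (a + b) * (A (Suc j) ^ a * B (Suc j) ^ b)"
proof -
  let ?d = "int (2 * j + 1 choose Suc j)"
  \<comment> \<open>Take u' and v' to be the negated next terms. The alternating sign in
    \<open>B\<close> makes v - v' a difference of binomials, while u - u' is a sum; Pascal's rule
    collapses both.\<close>
  have "B j - (- B (Suc j)) = - ((- 1) ^ j * int (m + Suc j choose Suc j))"
    by (simp add: B_def algebra_simps)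
  then have "A j * (B j - (- B (Suc j)))
      = - ((- 1) ^ j * int ((m choose j) * (m + Suc j choose Suc j)))"
    by (simp add: A_def)
  moreover have "?d dvd int ((m choose j) * (m + Suc j choose Suc j))"
    using central_binomial_dvd_binomial_mult1 int_dvd_int_iff by blast
  ultimately have 1: "?d dvd A j * (B j - (- B (Suc j)))"
    by (metis dvd_minus_iff dvd_mult)
  have "A j - (- A (Suc j)) = int (Suc m choose Suc j)"
    by (simp add: A_def)
  then have "(A j - (- A (Suc j))) * (- B (Suc j))
      = (- 1) ^ j * int ((Suc m choose Suc j) * (Suc m + Suc j choose Suc j))"
    by (simp only: B_def of_nat_mult power_Suc) (simp del: binomial_Suc_Suc)
  moreover have "?d dvd int ((Suc m choose Suc j) * (Suc m + Suc j choose Suc j))"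
    using central_binomial_dvd_binomial_mult2 int_dvd_int_iff by blast
  ultimately have 2: "?d dvd (A j - (- A (Suc j))) * (- B (Suc j))"
    by (metis dvd_mult)
  have "(- A (Suc j)) ^ a * (- B (Suc j)) ^ b
      = (- 1) ^ (a + b) * (A (Suc j) ^ a * B (Suc j) ^ b)"
    by (simp add: power_minus[of "A (Suc j)"] power_minus[of "B (Suc j)"] power_add mult_ac)
  then show ?thesis
    using dvd_diff_mult_powers[OF 1 2 assms(3,4)] by simp
qed

theorem theorem4p4:
  fixes a b n :: nat and f :: "nat \<Rightarrow> rat"
  assumes "a > 0" and "b > 0" and "n > 0"
    and "\<And>k. f k * ((2 * of_nat k - 1) gchoose k) \<in> \<int>"
  shows "(\<Sum>k = 0..n - 1. (f (k + 1) - (- 1) ^ (a + b) * f k)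
            * ((of_nat n - 1) gchoose k) ^ a * ((- of_nat n - 1) gchoose k) ^ b) \<in> \<int>"
proof -
  obtain m where n: "n = Suc m"
    using assms(3) gr0_implies_Suc by blast
  define c where "c k = int (m choose k) ^ a * ((- 1) ^ k * int (Suc m + k choose k)) ^ b" for k
  let ?s = "(- 1) ^ (a + b) :: rat"
  let ?C = "\<lambda>k. of_int (c k) :: rat"
  have c: "((of_nat n - 1 :: rat) gchoose k) ^ a * ((- of_nat n - 1) gchoose k) ^ b = ?C k" for k
  proof -
    have "((of_nat n - 1 :: rat) gchoose k) = of_nat (m choose k)"
      by (simp add: n binomial_gbinomial)
    then show ?thesis
      by (simp only: gbinomial_minus_of_nat c_def n) simp
  qed
  \<comment> \<open>At k = 0 the hypothesis involves binom(-1, 0) = 1.\<close>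
  have f0: "f 0 \<in> \<int>"
    using assms(4)[of 0] by simp
  have int_term: "f (k + 1) * (?C k - ?s * ?C (k + 1)) \<in> \<int>" for k
  proof -
    have "int (2 * k + 1 choose Suc k) dvd c k - (- 1) ^ (a + b) * c (Suc k)"
      unfolding c_def by (rule central_binomial_dvd_diff[OF assms(1,2)])
    then obtain z where z: "c k - (- 1) ^ (a + b) * c (Suc k) = int (2 * k + 1 choose Suc k) * z" ..
    \<comment> \<open>At index k + 1 the binomial in the hypothesis is exactly the divisor just
      obtained.\<close>
    have "(2 * of_nat (k + 1) - 1 :: rat) = of_nat (2 * k + 1)"
      by simp
    then have "f (k + 1) * of_nat (2 * k + 1 choose Suc k) \<in> \<int>"
      using assms(4)[of "k + 1"] by (simp only: binomial_gbinomial) simp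
    then have "f (k + 1) * of_nat (2 * k + 1 choose Suc k) * of_int z \<in> \<int>"
      by simp
    moreover have "?C k - ?s * ?C (k + 1) = of_nat (2 * k + 1 choose Suc k) * of_int z"
      using arg_cong[OF z, of "of_int :: int \<Rightarrow> rat"] by simp
    ultimately show ?thesis
      by (metis mult.assoc)
  qed
  \<comment> \<open>The upper boundary term must vanish because \<open>f n\<close> itself may be
    fractional: \<open>m choose n\<close> is 0 and a > 0. Only the integer multiple of
    \<open>f 0\<close> survives.\<close>
  have "c n = 0" "c 0 = 1"
    using assms(1) by (simp_all add: c_def n)
  then have "(\<Sum>k<n. (f (k + 1) - ?s * f k) * ?C k)
      = (\<Sum>k<n. f (k + 1) * (?C k - ?s * ?C (k + 1))) - ?s * f 0"
    using sum_by_parts_twisted[of f ?s ?C n] by simp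
  also have "\<dots> \<in> \<int>"
    by (intro Ints_diff Ints_sum int_term Ints_mult[OF _ f0]) simp
  finally have "(\<Sum>k<n. (f (k + 1) - ?s * f k) * ?C k) \<in> \<int>" .
  moreover have "{0..n - 1} = {..<n}"
    by (auto simp: n)
  ultimately show ?thesis
    by (simp only: mult.assoc c)
qed

end
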